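(* The map $\hat T_{slow}$ does not preserve any probability measure on $[0,1]^2$ that is absolutely continuous with respect to Lebesgue measure with bounded Radon–Nikodym derivative. However, $\hat T_{slow}$ preserves a $\sigma$-finite measure $\mu$ on $[0,1]^2$ which is mutually absolutely continuous with respect to Lebesgue measure and satisfies $\mu([0,1]^2)=\infty$.
   Context: $T(x)=\frac1x-\lfloor\frac1x\rfloor$ denotes the Gauss map. For $(x,y)\in[0,1]^2$ (defined up to a Lebesgue-null set, which is irrelevant here), $$\hat T_{slow}(x,y)=\begin{cases}\left(T(1-x),\frac{y}{1-x}\right), & 0\le y\le 1-x,\\ \left(T(x),\frac{1-y}{x}\right), & 1-x\le y\le 1.\end{cases}$$ *)

theory Defs
  imports "HOL-Probability.Probability"
begin

text \<open>Two-dimensional Lebesgue measure on the unit square, on its Borel sets.\<close>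

definition lebesgue_square :: "(real \<times> real) measure" where
  "lebesgue_square = restrict_space lborel ({0..1} \<times> {0..1})"

definition gauss_map :: "real \<Rightarrow> real" where
  "gauss_map x = 1 / x - of_int \<lfloor>1 / x\<rfloor>"

text \<open>
  The two branches overlap on the line \<open>y = 1 - x\<close>; the first one is used there. Together with
  \<open>1 / 0 = 0\<close> this fixes a version of the map that sends the whole square into itself.
  All measures considered below are absolutely continuous with respect to Lebesgue measure, so the
  choice made on this null set does not matter.
\<close>

definition T_slow :: "real \<times> real \<Rightarrow> real \<times> real" where
  "T_slow = (\<lambda>(x, y).
     if y \<le> 1 - x then (gauss_map (1 - x), y / (1 - x))
     else (gauss_map x, (1 - y) / x))"

definition preserves :: "('a \<Rightarrow> 'a) \<Rightarrow> 'a measure \<Rightarrow> bool" where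
  "preserves f M \<longleftrightarrow> f \<in> measurable M M \<and>
     (\<forall>A\<in>sets M. emeasure M (f -` A \<inter> space M) = emeasure M A)"

end

theory Submission
  imports Defs
begin

text \<open>
  The map is a skew product whose fibre maps \<open>y \<mapsto> y / (1 - x)\<close> and \<open>y \<mapsto> (1 - y) / x\<close> send
  \<open>[0, 1 - x]\<close> and \<open>[1 - x, 1]\<close> affinely onto \<open>[0, 1]\<close>. If \<open>y\<close> is uniform, the base point therefore
  performs the random walk that goes from \<open>x\<close> to \<open>T(1 - x)\<close> with probability \<open>1 - x\<close> and to \<open>T x\<close>
  with probability \<open>x\<close>, and the new fibre coordinate is again uniform. A density depending on \<open>x\<close>
  alone is thus invariant as soon as it is invariant for this walk. The density \<open>1 / x\<close> is: after
  reflecting the first branch by \<open>x \<mapsto> 1 - x\<close> the two contributions add up to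
  \<open>x / (1 - x) + 1 = 1 / (1 - x)\<close>, and the Gauss map carries \<open>dx / (1 - x)\<close> to
  \<open>(\<Sum>n\<ge>0. 1 / ((n + u) (n + 1 + u))) du\<close>, a telescoping series with sum \<open>1 / u\<close>.
  So \<open>\<mu> = dx dy / x\<close> is invariant, and it is infinite because \<open>1 / x\<close> is not integrable at \<open>0\<close>
  (\<open>preserves_slow_measure\<close>, \<open>emeasure_slow_measure_square\<close>).

  Now let \<open>\<nu>\<close> be an invariant probability with Lebesgue density at most \<open>C\<close>. Its density with respect
  to \<open>\<mu>\<close> is a function \<open>\<phi>\<close> with \<open>\<phi>(x, y) \<le> C x\<close>. As both measures are invariant and
  \<open>E = {\<phi> > t}\<close> has finite \<open>\<mu>\<close>-measure, \<open>E\<close> must be invariant modulo null sets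
  (\<open>null_sets_vimage_superlevel_diff\<close>), and the bound on \<open>\<phi>\<close> keeps \<open>E\<close> away from \<open>x = 0\<close>.
  But the inverse branch \<open>(u, v) \<mapsto> (u / (1 + u), v / (1 + u))\<close> of the map raises \<open>1 / u\<close> by one:
  pulling \<open>E\<close> back along it repeatedly would push almost all of \<open>E\<close> into every neighbourhood of
  \<open>x = 0\<close>. Hence \<open>E\<close> is null (\<open>null_set_bounded_away_backward_invariant\<close>), for every \<open>t > 0\<close>, so
  \<open>\<phi> = 0\<close> almost everywhere, which contradicts \<open>\<nu>\<close> having mass one.
\<close>

section \<open>The map on the square\<close>

lemma gauss_map_nonneg: "0 \<le> gauss_map x"
  by (simp add: gauss_map_def)

lemma gauss_map_less_1: "gauss_map x < 1"
  unfolding gauss_map_def by linarith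

lemma gauss_map_inverse_branch:
  assumes "0 \<le> u" "u < 1"
  shows "gauss_map (1 / (real n + u)) = u"
proof -
  have "\<lfloor>real n + u\<rfloor> = int n"
    using assms by (intro floor_unique) auto
  then show ?thesis
    by (simp add: gauss_map_def)
qed

lemma gauss_map_measurable [measurable]: "gauss_map \<in> borel_measurable borel"
  unfolding gauss_map_def by measurable

lemma fst_borel_measurable [measurable]: "fst \<in> (borel :: (real \<times> real) measure) \<rightarrow>\<^sub>M borel"
  by (simp add: borel_prod[symmetric])

lemma T_slow_measurable [measurable]: "T_slow \<in> borel \<rightarrow>\<^sub>M borel"
  unfolding T_slow_def case_prod_beta borel_prod[symmetric] by measurable

lemma T_slow_in_square:
  assumes "p \<in> {0..1} \<times> {0..1}"
  shows "T_slow p \<in> {0..1} \<times> {0..1}"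
  using assms gauss_map_nonneg gauss_map_less_1[THEN less_imp_le]
  by (auto simp: T_slow_def divide_simps)

lemma square_borel [measurable, simp]: "{0..1::real} \<times> {0..1::real} \<in> sets borel"
  by (auto intro!: borel_closed closed_Times)

lemma space_lebesgue_square [simp]: "space lebesgue_square = {0..1} \<times> {0..1}"
  by (simp add: lebesgue_square_def space_restrict_space)

lemma in_sets_lebesgue_square:
  "A \<in> sets lebesgue_square \<longleftrightarrow> A \<in> sets borel \<and> A \<subseteq> {0..1} \<times> {0..1}"
  unfolding lebesgue_square_def by (subst sets_restrict_space_iff) auto

lemma borel_measurable_lebesgue_square [measurable (raw)]:
  "f \<in> measurable borel N \<Longrightarrow> f \<in> measurable lebesgue_square N"
  unfolding lebesgue_square_def by (intro measurable_restrict_space1) simp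

lemma T_slow_measurable_square: "T_slow \<in> lebesgue_square \<rightarrow>\<^sub>M lebesgue_square"
  unfolding lebesgue_square_def
  using T_slow_in_square by (intro measurable_restrict_space3) (auto simp: )

lemma sigma_finite_lebesgue_square: "sigma_finite_measure lebesgue_square"
  unfolding lebesgue_square_def
  by (intro sigma_finite_measure_restrict_space sigma_finite_lborel) auto

lemma nn_integral_lebesgue_square:
  assumes [measurable]: "f \<in> borel_measurable borel"
  shows "(\<integral>\<^sup>+ p. f p \<partial>lebesgue_square) =
    (\<integral>\<^sup>+ x\<in>{0..1}. (\<integral>\<^sup>+ y\<in>{0..1}. f (x, y) \<partial>lborel) \<partial>lborel)"
proof -
  have [measurable]: "f \<in> borel_measurable (borel \<Otimes>\<^sub>M borel)"
    by (simp add: borel_prod)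
  have "(\<integral>\<^sup>+ p. f p \<partial>lebesgue_square) =
      (\<integral>\<^sup>+ p. f p * indicator ({0..1} \<times> {0..1}) p \<partial>(lborel \<Otimes>\<^sub>M lborel))"
    unfolding lebesgue_square_def lborel_prod by (subst nn_integral_restrict_space) auto
  also have "\<dots> = (\<integral>\<^sup>+ x. \<integral>\<^sup>+ y. f (x, y) * indicator ({0..1} \<times> {0..1}) (x, y) \<partial>lborel \<partial>lborel)"
    by (subst lborel.nn_integral_fst[symmetric]) auto
  also have "\<dots> = (\<integral>\<^sup>+ x\<in>{0..1}. (\<integral>\<^sup>+ y\<in>{0..1}. f (x, y) \<partial>lborel) \<partial>lborel)"
    by (intro nn_integral_cong) (auto simp: indicator_def)
  finally show ?thesis .
qed

section \<open>A change of variables for the Gauss map\<close>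

lemma sums_inverse_consecutive_products:
  fixes u :: real
  assumes "0 < u"
  shows "(\<lambda>n. 1 / ((real n + u) * (real n + 1 + u))) sums (1 / u)"
proof -
  have "(\<lambda>n. 1 / (real n + u)) \<longlonglongrightarrow> 0"
    by real_asymp
  from telescope_sums'[OF this]
  have "(\<lambda>n. 1 / (real n + u) - 1 / (real (Suc n) + u)) sums (1 / u)"
    by simp
  moreover have "1 / (real n + u) - 1 / (real (Suc n) + u) = 1 / ((real n + u) * (real n + 1 + u))" for n
  proof -
    have "real n + u > 0" using assms by simp
    then show ?thesis by (simp add: field_simps)
  qed
  ultimately show ?thesis by simp
qed

lemma Union_reciprocal_intervals:
  "(\<Union>n. {1 / (real n + 2)<..1 / (real n + 1)}) = {0<..1}"
proof (intro equalityI subsetI)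
  fix x :: real assume "x \<in> {0<..1}"
  then have x: "0 < x" "x \<le> 1" by auto
  define n where "n = nat (\<lfloor>1 / x\<rfloor> - 1)"
  have "\<lfloor>1 / x\<rfloor> \<ge> 1" using x by (simp add: le_floor_iff)
  then have "real n = of_int \<lfloor>1 / x\<rfloor> - 1" by (simp add: n_def)
  then have "real n + 1 \<le> 1 / x" "1 / x < real n + 2" by linarith+
  then have "x \<in> {1 / (real n + 2)<..1 / (real n + 1)}"
    using x by (auto simp: field_simps)
  then show "x \<in> (\<Union>n. {1 / (real n + 2)<..1 / (real n + 1)})" by blast
next
  fix x :: real assume "x \<in> (\<Union>n. {1 / (real n + 2)<..1 / (real n + 1)})"
  then obtain n where n: "1 / (real n + 2) < x" "x \<le> 1 / (real n + 1)" by auto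
  have "0 < 1 / (real n + 2)" "1 / (real n + 1) \<le> 1" by auto
  then show "x \<in> {0<..1}" using n by (simp only: greaterThanAtMost_iff) linarith
qed

lemma disjoint_family_reciprocal_intervals:
  "disjoint_family (\<lambda>n. {1 / (real n + 2)<..1 / (real n + 1)})"
  unfolding disjoint_family_on_def
proof (intro ballI impI)
  have *: "{1 / (real m + 2)<..1 / (real m + 1)} \<inter> {1 / (real n + 2)<..1 / (real n + 1)} = {}"
    if "m < n" for m n :: nat
  proof -
    have "1 / (real n + 1) \<le> 1 / (real m + 2)"
      using that by (intro divide_left_mono) auto
    then show ?thesis by auto
  qed
  fix m n :: nat assume "m \<noteq> n"
  then show "{1 / (real m + 2)<..1 / (real m + 1)} \<inter> {1 / (real n + 2)<..1 / (real n + 1)} = {}"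
    using *[of m n] *[of n m] by (cases "m < n") auto
qed

text \<open>
  On the interval where \<open>\<lfloor>1 / x\<rfloor> = n + 1\<close> the Gauss map is inverted by \<open>u \<mapsto> 1 / (n + 1 + u)\<close>; the
  weight on the right is the Jacobian \<open>1 / (n + 1 + u)\<^sup>2\<close> times \<open>1 / (1 - x) = (n + 1 + u) / (n + u)\<close>.
\<close>

lemma nn_integral_gauss_branch:
  assumes [measurable]: "f \<in> borel_measurable borel"
  shows "(\<integral>\<^sup>+ x\<in>{1 / (real n + 2)<..1 / (real n + 1)}. f (gauss_map x) * ennreal (1 / (1 - x)) \<partial>lborel) =
    (\<integral>\<^sup>+ u\<in>{0..1}. f u * ennreal (1 / ((real n + u) * (real n + 1 + u))) \<partial>lborel)"
proof -
  define h where "h x = f (gauss_map x) * ennreal (1 / (1 - x))" for x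
  \<comment> \<open>The substitution rule asks for an increasing function, hence the sign.\<close>
  define g where "g u = - (1 / (real n + 1 + u))" for u
  have g_ends: "g 0 = - (1 / (real n + 1))" "g 1 = - (1 / (real n + 2))"
    by (simp_all add: g_def)
  have [measurable]: "h \<in> borel_measurable borel"
    unfolding h_def by measurable
  have "(\<integral>\<^sup>+ x\<in>{1 / (real n + 2)<..1 / (real n + 1)}. h x \<partial>lborel) =
      (\<integral>\<^sup>+ x\<in>{1 / (real n + 2)..1 / (real n + 1)}. h x \<partial>lborel)"
    using AE_lborel_singleton[of "1 / (real n + 2)"]
    by (intro nn_integral_cong_AE) (auto simp: indicator_def elim!: eventually_mono)
  also have "\<dots> = (\<integral>\<^sup>+ z. h (- z) * indicator {1 / (real n + 2)..1 / (real n + 1)} (- z) \<partial>lborel)"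
    by (subst nn_integral_real_affine[where c = "-1" and t = 0]) auto
  also have "\<dots> = (\<integral>\<^sup>+ z\<in>{g 0..g 1}. h (- z) \<partial>lborel)"
    by (intro nn_integral_cong) (auto simp: indicator_def g_ends)
  also have "\<dots> = (\<integral>\<^sup>+ u. h (- g u) * ennreal (1 / (real n + 1 + u)\<^sup>2) * indicator {0..1} u \<partial>lborel)"
    unfolding g_def
    by (rule nn_integral_substitution_aux)
       (auto intro!: derivative_eq_intros continuous_intros simp: power2_eq_square)
  also have "\<dots> = (\<integral>\<^sup>+ u\<in>{0..1}. f u * ennreal (1 / ((real n + u) * (real n + 1 + u))) \<partial>lborel)"
  proof (rule nn_integral_cong_AE)
    show "AE u in lborel. h (- g u) * ennreal (1 / (real n + 1 + u)\<^sup>2) * indicator {0..1} u =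
        f u * ennreal (1 / ((real n + u) * (real n + 1 + u))) * indicator {0..1} u"
      using AE_lborel_singleton[of 0] AE_lborel_singleton[of 1]
    proof eventually_elim
      case (elim u)
      show ?case
      proof (cases "u \<in> {0..1}")
        case True
        with elim have u: "0 < u" "u < 1" by auto
        have pos: "real n + u > 0" "real n + 1 + u > 0" using u by auto
        have eq: "1 / (1 - 1 / (real n + 1 + u)) * (1 / (real n + 1 + u)\<^sup>2)
            = 1 / ((real n + u) * (real n + 1 + u))"
        proof -
          have "1 - 1 / (real n + 1 + u) = (real n + u) / (real n + 1 + u)"
            using pos by (simp add: field_simps)
          then show ?thesis
            using pos by (simp add: power2_eq_square)
        qed
        have "1 / (1 - 1 / (real n + 1 + u)) \<ge> 0"
          using pos by (simp add: field_simps)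
        then have "ennreal (1 / (1 - 1 / (real n + 1 + u))) * ennreal (1 / (real n + 1 + u)\<^sup>2)
            = ennreal (1 / ((real n + u) * (real n + 1 + u)))"
          by (subst ennreal_mult[symmetric]) (simp_all only: eq, auto)
        moreover have "gauss_map (1 / (real n + 1 + u)) = u"
          using gauss_map_inverse_branch[of u "Suc n"] u by (simp add: add_ac)
        ultimately show ?thesis by (simp add: h_def g_def mult.assoc)
      qed simp
    qed
  qed
  finally show ?thesis by (simp add: h_def)
qed

text \<open>Summing over the branches, the weights of \<open>nn_integral_gauss_branch\<close> telescope to \<open>1 / u\<close>.\<close>

lemma nn_integral_gauss_map:
  assumes [measurable]: "f \<in> borel_measurable borel"
  shows "(\<integral>\<^sup>+ x\<in>{0..1}. f (gauss_map x) * ennreal (1 / (1 - x)) \<partial>lborel) =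
    (\<integral>\<^sup>+ u\<in>{0..1}. f u * ennreal (1 / u) \<partial>lborel)"
proof -
  have "(\<integral>\<^sup>+ x\<in>{0..1}. f (gauss_map x) * ennreal (1 / (1 - x)) \<partial>lborel) =
      (\<integral>\<^sup>+ x\<in>(\<Union>n. {1 / (real n + 2)<..1 / (real n + 1)}).
        f (gauss_map x) * ennreal (1 / (1 - x)) \<partial>lborel)"
    unfolding Union_reciprocal_intervals using AE_lborel_singleton[of 0]
    by (intro nn_integral_cong_AE) (auto simp: indicator_def elim!: eventually_mono)
  also have "\<dots> = (\<Sum>n. \<integral>\<^sup>+ x\<in>{1 / (real n + 2)<..1 / (real n + 1)}.
        f (gauss_map x) * ennreal (1 / (1 - x)) \<partial>lborel)"
    by (rule nn_integral_disjoint_family) (auto simp: disjoint_family_reciprocal_intervals)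
  also have "\<dots> = (\<integral>\<^sup>+ u. (\<Sum>n. f u * ennreal (1 / ((real n + u) * (real n + 1 + u))) * indicator {0..1} u) \<partial>lborel)"
    unfolding nn_integral_gauss_branch[OF assms] by (rule nn_integral_suminf[symmetric]) measurable
  also have "\<dots> = (\<integral>\<^sup>+ u\<in>{0..1}. f u * ennreal (1 / u) \<partial>lborel)"
  proof (rule nn_integral_cong_AE)
    show "AE u in lborel. (\<Sum>n. f u * ennreal (1 / ((real n + u) * (real n + 1 + u))) * indicator {0..1} u) =
        f u * ennreal (1 / u) * indicator {0..1} u"
      using AE_lborel_singleton[of 0]
    proof eventually_elim
      case (elim u)
      show ?case
      proof (cases "u \<in> {0..1}")
        case True
        with elim have "0 < u" by auto
        then have "(\<Sum>n. ennreal (1 / ((real n + u) * (real n + 1 + u)))) = ennreal (1 / u)"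
          by (intro suminf_ennreal_eq sums_inverse_consecutive_products) auto
        then show ?thesis using True by simp
      qed simp
    qed
  qed
  finally show ?thesis .
qed

section \<open>The invariant measure\<close>

text \<open>
  Both fibre maps are affine onto \<open>[0, 1]\<close>, so Lebesgue measure on a fibre is sent to a mixture of
  Lebesgue measures on two fibres, weighted by the lengths \<open>1 - x\<close> and \<open>x\<close> of the two pieces.
\<close>

lemma nn_integral_T_slow_fibre:
  assumes G [measurable]: "G \<in> borel_measurable (borel :: (real \<times> real) measure)"
    and x: "0 < x" "x < 1"
  defines "\<Gamma> \<equiv> \<lambda>u. \<integral>\<^sup>+ v\<in>{0..1}. G (u, v) \<partial>lborel"
  shows "(\<integral>\<^sup>+ y\<in>{0..1}. G (T_slow (x, y)) \<partial>lborel) =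
    ennreal (1 - x) * \<Gamma> (gauss_map (1 - x)) + ennreal x * \<Gamma> (gauss_map x)"
proof -
  have [measurable]: "(\<lambda>v. G (u, v)) \<in> borel_measurable borel" for u
    by (rule measurable_compose[OF _ G]) (simp add: borel_prod[symmetric])
  have "(\<integral>\<^sup>+ y\<in>{0..1}. G (T_slow (x, y)) \<partial>lborel) =
      (\<integral>\<^sup>+ y. G (gauss_map (1 - x), y / (1 - x)) * indicator {0..1 - x} y +
        G (gauss_map x, (1 - y) / x) * indicator {1 - x<..1} y \<partial>lborel)"
    using x by (intro nn_integral_cong) (auto simp: T_slow_def indicator_def)
  also have "\<dots> = (\<integral>\<^sup>+ y\<in>{0..1 - x}. G (gauss_map (1 - x), y / (1 - x)) \<partial>lborel) +
      (\<integral>\<^sup>+ y\<in>{1 - x<..1}. G (gauss_map x, (1 - y) / x) \<partial>lborel)"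
    by (rule nn_integral_add) measurable
  also have "(\<integral>\<^sup>+ y\<in>{0..1 - x}. G (gauss_map (1 - x), y / (1 - x)) \<partial>lborel) =
      ennreal (1 - x) * \<Gamma> (gauss_map (1 - x))"
  proof -
    have "(\<integral>\<^sup>+ y\<in>{0..1 - x}. G (gauss_map (1 - x), y / (1 - x)) \<partial>lborel) =
      ennreal (1 - x) * (\<integral>\<^sup>+ v. G (gauss_map (1 - x), (1 - x) * v / (1 - x)) * indicator {0..1 - x} ((1 - x) * v) \<partial>lborel)"
      using x by (subst nn_integral_real_affine[where c = "1 - x" and t = 0]) auto
    also have "(\<integral>\<^sup>+ v. G (gauss_map (1 - x), (1 - x) * v / (1 - x)) * indicator {0..1 - x} ((1 - x) * v) \<partial>lborel)
      = \<Gamma> (gauss_map (1 - x))"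
      unfolding \<Gamma>_def using x
      by (intro nn_integral_cong) (auto simp: indicator_def zero_le_mult_iff mult_le_cancel_left1)
    finally show ?thesis .
  qed
  also have "(\<integral>\<^sup>+ y\<in>{1 - x<..1}. G (gauss_map x, (1 - y) / x) \<partial>lborel) =
      ennreal x * \<Gamma> (gauss_map x)"
  proof -
    have "(\<integral>\<^sup>+ y\<in>{1 - x<..1}. G (gauss_map x, (1 - y) / x) \<partial>lborel) =
      ennreal x * (\<integral>\<^sup>+ v. G (gauss_map x, v) * indicator {1 - x<..1} (1 - x * v) \<partial>lborel)"
      using x by (subst nn_integral_real_affine[where c = "- x" and t = 1]) auto
    also have "(\<integral>\<^sup>+ v. G (gauss_map x, v) * indicator {1 - x<..1} (1 - x * v) \<partial>lborel) = \<Gamma> (gauss_map x)"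
      unfolding \<Gamma>_def using x AE_lborel_singleton[of 1]
      by (intro nn_integral_cong_AE) (auto simp: indicator_def zero_le_mult_iff elim!: eventually_mono)
    finally show ?thesis .
  qed
  finally show ?thesis .
qed

text \<open>
  Integrating over the fibres leaves an integral of \<open>\<Gamma>(T(1 - x)) (1 - x) / x + \<Gamma>(T x)\<close>. Reflecting
  the first summand gives \<open>\<Gamma>(T x) / (1 - x)\<close>, to which the one-dimensional change of variables
  applies.
\<close>

lemma nn_integral_T_slow:
  assumes G [measurable]: "G \<in> borel_measurable (borel :: (real \<times> real) measure)"
  shows "(\<integral>\<^sup>+ p. ennreal (1 / fst p) * G (T_slow p) \<partial>lebesgue_square) =
    (\<integral>\<^sup>+ p. ennreal (1 / fst p) * G p \<partial>lebesgue_square)"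
proof -
  define \<Gamma> where "\<Gamma> u = (\<integral>\<^sup>+ v\<in>{0..1}. G (u, v) \<partial>lborel)" for u
  have [measurable]: "G \<in> borel_measurable (borel \<Otimes>\<^sub>M borel)"
    by (simp add: borel_prod)
  have [measurable]: "T_slow \<in> borel \<Otimes>\<^sub>M borel \<rightarrow>\<^sub>M borel"
    by (simp add: borel_prod)
  have [measurable]: "(\<lambda>y. T_slow (x, y)) \<in> borel \<rightarrow>\<^sub>M borel" for x
    by measurable
  have [measurable]: "\<Gamma> \<in> borel_measurable borel"
    unfolding \<Gamma>_def by measurable
  have "(\<integral>\<^sup>+ p. ennreal (1 / fst p) * G (T_slow p) \<partial>lebesgue_square) =
      (\<integral>\<^sup>+ x\<in>{0..1}. ennreal (1 / x) * (\<integral>\<^sup>+ y\<in>{0..1}. G (T_slow (x, y)) \<partial>lborel) \<partial>lborel)"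
    by (subst nn_integral_lebesgue_square) (simp_all add: mult.assoc nn_integral_cmult)
  also have "\<dots> = (\<integral>\<^sup>+ x. ennreal ((1 - x) / x) * \<Gamma> (gauss_map (1 - x)) * indicator {0..1} x +
        \<Gamma> (gauss_map x) * indicator {0..1} x \<partial>lborel)"
  proof (rule nn_integral_cong_AE)
    show "AE x in lborel. ennreal (1 / x) * (\<integral>\<^sup>+ y\<in>{0..1}. G (T_slow (x, y)) \<partial>lborel) * indicator {0..1} x =
        ennreal ((1 - x) / x) * \<Gamma> (gauss_map (1 - x)) * indicator {0..1} x +
        \<Gamma> (gauss_map x) * indicator {0..1} x"
      using AE_lborel_singleton[of 0] AE_lborel_singleton[of 1]
    proof eventually_elim
      case (elim x)
      show ?case
      proof (cases "x \<in> {0..1}")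
        case True
        with elim have x: "0 < x" "x < 1" by auto
        have 1: "ennreal (1 / x) * ennreal (1 - x) = ennreal ((1 - x) / x)"
          using x by (subst ennreal_mult[symmetric]) auto
        have 2: "ennreal (1 / x) * ennreal x = 1"
          using x by (subst ennreal_mult[symmetric]) auto
        show ?thesis
          using True
          by (simp add: nn_integral_T_slow_fibre[OF G x] \<Gamma>_def[symmetric] distrib_left 1 2
              mult.assoc[symmetric])
      qed simp
    qed
  qed
  also have "\<dots> = (\<integral>\<^sup>+ x\<in>{0..1}. ennreal ((1 - x) / x) * \<Gamma> (gauss_map (1 - x)) \<partial>lborel) +
        (\<integral>\<^sup>+ x\<in>{0..1}. \<Gamma> (gauss_map x) \<partial>lborel)"
    by (rule nn_integral_add) measurable
  also have "(\<integral>\<^sup>+ x\<in>{0..1}. ennreal ((1 - x) / x) * \<Gamma> (gauss_map (1 - x)) \<partial>lborel) =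
      (\<integral>\<^sup>+ x\<in>{0..1}. ennreal (x / (1 - x)) * \<Gamma> (gauss_map x) \<partial>lborel)"
    by (subst nn_integral_real_affine[where c = "-1" and t = 1])
       (auto intro!: nn_integral_cong simp: indicator_def)
  also have "\<dots> + (\<integral>\<^sup>+ x\<in>{0..1}. \<Gamma> (gauss_map x) \<partial>lborel) =
      (\<integral>\<^sup>+ x. ennreal (x / (1 - x)) * \<Gamma> (gauss_map x) * indicator {0..1} x +
        \<Gamma> (gauss_map x) * indicator {0..1} x \<partial>lborel)"
    by (rule nn_integral_add[symmetric]) measurable
  also have "\<dots> = (\<integral>\<^sup>+ x\<in>{0..1}. \<Gamma> (gauss_map x) * ennreal (1 / (1 - x)) \<partial>lborel)"
  proof (rule nn_integral_cong_AE)
    show "AE x in lborel. ennreal (x / (1 - x)) * \<Gamma> (gauss_map x) * indicator {0..1} x +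
        \<Gamma> (gauss_map x) * indicator {0..1} x =
        \<Gamma> (gauss_map x) * ennreal (1 / (1 - x)) * indicator {0..1} x"
      using AE_lborel_singleton[of 1]
    proof eventually_elim
      case (elim x)
      show ?case
      proof (cases "x \<in> {0..1}")
        case True
        with elim have x: "0 \<le> x" "x < 1" by auto
        have "ennreal (x / (1 - x)) + 1 = ennreal (1 / (1 - x))"
          using x by (subst ennreal_1[symmetric], subst ennreal_plus[symmetric]) (auto simp: field_simps)
        then have "\<Gamma> (gauss_map x) * ennreal (1 / (1 - x)) =
            \<Gamma> (gauss_map x) * ennreal (x / (1 - x)) + \<Gamma> (gauss_map x)"
          by (metis distrib_left mult.right_neutral)
        then show ?thesis using True by (simp add: mult.commute)
      qed simp
    qed
  qed
  also have "\<dots> = (\<integral>\<^sup>+ u\<in>{0..1}. \<Gamma> u * ennreal (1 / u) \<partial>lborel)"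
    by (rule nn_integral_gauss_map) measurable
  also have "\<dots> = (\<integral>\<^sup>+ p. ennreal (1 / fst p) * G p \<partial>lebesgue_square)"
    by (subst nn_integral_lebesgue_square)
       (simp_all add: mult.assoc nn_integral_cmult \<Gamma>_def mult.left_commute mult.commute)
  finally show ?thesis .
qed


definition slow_measure :: "(real \<times> real) measure" where
  "slow_measure = density lebesgue_square (\<lambda>p. ennreal (1 / fst p))"

lemma sets_slow_measure [simp, measurable_cong]: "sets slow_measure = sets lebesgue_square"
  by (simp add: slow_measure_def)

lemma space_slow_measure [simp]: "space slow_measure = {0..1} \<times> {0..1}"
  by (simp add: slow_measure_def)

lemma AE_fst_neq: "AE p in lebesgue_square. fst p \<noteq> c"
proof -
  have line: "{p \<in> space lebesgue_square. fst p = c} \<in> sets lebesgue_square"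
    by measurable
  have "emeasure lebesgue_square {p \<in> space lebesgue_square. fst p = c} =
      (\<integral>\<^sup>+ p. indicator {p \<in> space lebesgue_square. fst p = c} p \<partial>lebesgue_square)"
    by (rule nn_integral_indicator[OF line, symmetric])
  also have "\<dots> =
    (\<integral>\<^sup>+ p. indicator {c} (fst p) \<partial>lebesgue_square)"
    by (intro nn_integral_cong) (simp add: indicator_def)
  also have "\<dots> = (\<integral>\<^sup>+ x. 0 \<partial>(lborel :: real measure))"
  proof -
    have "AE x in lborel. (\<integral>\<^sup>+ y\<in>{0..1}. indicator {c} (fst (x, y :: real)) \<partial>lborel)
        * indicator {0..1} x = (0 :: ennreal)"
      using AE_lborel_singleton[of c] by eventually_elim simp
    then have "(\<integral>\<^sup>+ x\<in>{0..1}. (\<integral>\<^sup>+ y\<in>{0..1}. indicator {c} (fst (x, y :: real)) \<partial>lborel) \<partial>lborel)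
        = (\<integral>\<^sup>+ x. 0 \<partial>(lborel :: real measure))"
      by (rule nn_integral_cong_AE)
    moreover have "(\<lambda>p :: real \<times> real. indicator {c} (fst p) :: ennreal) \<in> borel_measurable borel"
      by (rule measurable_compose[OF fst_borel_measurable]) simp
    ultimately show ?thesis
      by (simp only: nn_integral_lebesgue_square)
  qed
  finally show ?thesis
    using line by (subst AE_iff_measurable[OF _ refl]) simp_all
qed

lemma null_sets_slow_measure: "null_sets slow_measure = null_sets lebesgue_square"
proof (intro set_eqI iffI)
  fix A assume A: "A \<in> null_sets slow_measure"
  then have sets: "A \<in> sets lebesgue_square"
    and zero: "AE p in lebesgue_square. p \<in> A \<longrightarrow> ennreal (1 / fst p) = 0"
    by (auto simp: slow_measure_def null_sets_density_iff)
  from zero have "AE p in lebesgue_square. p \<notin> A"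
    using AE_fst_neq[of 0] AE_space by eventually_elim (auto simp: ennreal_eq_0_iff)
  then show "A \<in> null_sets lebesgue_square"
    using sets by (simp add: AE_iff_null_sets)
next
  fix A assume "A \<in> null_sets lebesgue_square"
  then show "A \<in> null_sets slow_measure"
    by (auto simp: slow_measure_def null_sets_density_iff dest: AE_not_in elim!: eventually_mono)
qed

lemma sigma_finite_slow_measure: "sigma_finite_measure slow_measure"
  unfolding slow_measure_def
  by (subst sigma_finite_measure.sigma_finite_iff_density_finite[OF sigma_finite_lebesgue_square]) auto

lemma preserves_slow_measure: "preserves T_slow slow_measure"
  unfolding preserves_def
proof (intro conjI ballI)
  show "T_slow \<in> slow_measure \<rightarrow>\<^sub>M slow_measure"
    using T_slow_measurable_square by (simp cong: measurable_cong_sets)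
next
  fix A assume "A \<in> sets slow_measure"
  then have A: "A \<in> sets lebesgue_square" and [measurable]: "A \<in> sets borel"
    by (auto simp: in_sets_lebesgue_square)
  have TA: "T_slow -` A \<inter> space lebesgue_square \<in> sets lebesgue_square"
    using measurable_sets[OF T_slow_measurable_square A] .
  have "emeasure slow_measure (T_slow -` A \<inter> space slow_measure) =
      (\<integral>\<^sup>+ p. ennreal (1 / fst p) * indicator A (T_slow p) \<partial>lebesgue_square)"
    using TA unfolding slow_measure_def
    by (subst emeasure_density) (auto intro!: nn_integral_cong simp: indicator_def)
  also have "\<dots> = (\<integral>\<^sup>+ p. ennreal (1 / fst p) * indicator A p \<partial>lebesgue_square)"
    by (rule nn_integral_T_slow) simp
  also have "\<dots> = emeasure slow_measure A"
    using A unfolding slow_measure_def by (subst emeasure_density) auto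
  finally show "emeasure slow_measure (T_slow -` A \<inter> space slow_measure) = emeasure slow_measure A" .
qed

text \<open>The substitution \<open>x = exp t\<close> shows that \<open>[exp (-n), 1]\<close> contributes \<open>n\<close> to the total mass.\<close>

lemma emeasure_slow_measure_square: "emeasure slow_measure ({0..1} \<times> {0..1}) = \<infinity>"
proof -
  have total: "emeasure slow_measure ({0..1} \<times> {0..1}) = (\<integral>\<^sup>+ x\<in>{0..1}. ennreal (1 / x) \<partial>lborel)"
  proof -
    have "emeasure slow_measure ({0..1} \<times> {0..1}) = (\<integral>\<^sup>+ p. ennreal (1 / fst p) \<partial>lebesgue_square)"
      unfolding slow_measure_def
      by (subst emeasure_density)
         (auto simp: in_sets_lebesgue_square intro!: nn_integral_cong)
    also have "\<dots> = (\<integral>\<^sup>+ x\<in>{0..1}. ennreal (1 / x) \<partial>lborel)"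
      by (subst nn_integral_lebesgue_square) (auto simp: nn_integral_cmult)
    finally show ?thesis .
  qed
  have "of_nat n \<le> emeasure slow_measure ({0..1} \<times> {0..1})" for n :: nat
  proof (cases "n = 0")
    case False
    have "of_nat n = (\<integral>\<^sup>+ t. indicator {- real n..0} t \<partial>lborel)"
      by (simp add: ennreal_of_nat_eq_real_of_nat)
    also have "\<dots> = (\<integral>\<^sup>+ t. ennreal (1 / exp t) * ennreal (exp t) * indicator {- real n..0} t \<partial>lborel)"
      by (intro nn_integral_cong) (simp add: ennreal_mult[symmetric])
    also have "\<dots> = (\<integral>\<^sup>+ x\<in>{exp (- real n)..exp 0}. ennreal (1 / x) \<partial>lborel)"
      using False
      by (intro nn_integral_substitution_aux[symmetric])
         (auto intro!: derivative_eq_intros continuous_intros)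
    also have "\<dots> \<le> (\<integral>\<^sup>+ x\<in>{0..1}. ennreal (1 / x) \<partial>lborel)"
      by (intro nn_integral_mono) (auto simp: indicator_def intro: order_trans[OF exp_ge_zero])
    finally show ?thesis by (simp add: total)
  qed simp
  then show ?thesis
    by (metis ennreal_Ex_less_of_nat infinity_ennreal_def leD top.not_eq_extremum)
qed

section \<open>Invariant densities have invariant superlevel sets\<close>

text \<open>
  Write \<open>F\<close> for the preimage of \<open>E\<close>, and \<open>N\<close> for the measure with density \<open>\<phi>\<close>. Since \<open>E\<close> and \<open>F\<close>
  have equal finite measure under \<open>M\<close> and under \<open>N\<close>, so do \<open>E - F\<close> and \<open>F - E\<close>. But \<open>N\<close> exceeds
  \<open>t \<cdot> M\<close> on the former, strictly unless it is null, and is at most \<open>t \<cdot> M\<close> on the latter. The measure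
  \<open>M\<close> may be infinite: Markov's inequality makes \<open>E\<close> of finite measure.
\<close>

lemma null_sets_vimage_superlevel_diff:
  fixes t :: real
  assumes \<phi> [measurable]: "\<phi> \<in> borel_measurable M"
    and M: "preserves T M" and N: "preserves T (density M \<phi>)"
    and fin: "emeasure (density M \<phi>) (space M) < \<infinity>" and t: "0 < t"
  defines "E \<equiv> {p \<in> space M. ennreal t < \<phi> p}"
  shows "(T -` E \<inter> space M) - E \<in> null_sets M"
proof -
  have [measurable]: "T \<in> M \<rightarrow>\<^sub>M M"
    using M by (simp add: preserves_def)
  define F where "F = T -` E \<inter> space M"
  have [measurable]: "E \<in> sets M"
    unfolding E_def by measurable
  have [measurable]: "F \<in> sets M"
    unfolding F_def by measurable
  let ?N = "density M \<phi>"
  have eqM: "emeasure M F = emeasure M E" and eqN: "emeasure ?N F = emeasure ?N E"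
    using M N by (auto simp: preserves_def F_def)
  have finN: "emeasure ?N A < \<infinity>" if "A \<in> sets M" for A
    using le_less_trans[OF emeasure_mono[of A "space M" ?N] fin] that sets.sets_into_space[OF that] by auto
  have "ennreal t * emeasure M E = (\<integral>\<^sup>+ p\<in>E. ennreal t \<partial>M)"
    by (simp add: nn_integral_cmult_indicator)
  also have "\<dots> \<le> emeasure ?N E"
    by (subst emeasure_density) (auto intro!: nn_integral_mono simp: indicator_def E_def)
  finally have "ennreal t * emeasure M E < \<infinity>"
    using finN[of E] by (simp add: le_less_trans)
  then have finE: "emeasure M E < \<infinity>"
    using t by (auto simp: ennreal_mult_less_top)
  have split: "emeasure L E = emeasure L (E \<inter> F) + emeasure L (E - F)"
      "emeasure L F = emeasure L (E \<inter> F) + emeasure L (F - E)" if "sets L = sets M" for L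
    using that by (subst plus_emeasure; auto intro!: arg_cong[where f = "emeasure L"])+
  have finI: "emeasure M (E \<inter> F) < \<infinity>" "emeasure M (E - F) < \<infinity>"
    by (rule le_less_trans[OF emeasure_mono finE]; auto)+
  have M12: "emeasure M (F - E) = emeasure M (E - F)"
    using split[of M] eqM finI by (auto simp: ennreal_add_left_cancel)
  have N12: "emeasure ?N (F - E) = emeasure ?N (E - F)"
    using split[of ?N] eqN finN[of "E \<inter> F"] by (auto simp: ennreal_add_left_cancel)
  \<comment> \<open>The excess of \<open>N\<close> over \<open>t \<cdot> M\<close> on \<open>E - F\<close>, to be shown to vanish.\<close>
  let ?R = "\<integral>\<^sup>+ p. (\<phi> p - ennreal t) * indicator (E - F) p \<partial>M"
  have "ennreal t * emeasure M (E - F) + ?R =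
      (\<integral>\<^sup>+ p. ennreal t * indicator (E - F) p + (\<phi> p - ennreal t) * indicator (E - F) p \<partial>M)"
    by (subst nn_integral_add) (auto simp: nn_integral_cmult_indicator)
  also have "\<dots> = emeasure ?N (E - F)"
    by (subst emeasure_density)
       (auto intro!: nn_integral_cong simp: indicator_def E_def add_diff_inverse_ennreal less_imp_le)
  also have "\<dots> = emeasure ?N (F - E)"
    using N12 by simp
  also have "\<dots> \<le> (\<integral>\<^sup>+ p\<in>F - E. ennreal t \<partial>M)"
    by (subst emeasure_density) (auto intro!: nn_integral_mono simp: indicator_def E_def F_def)
  also have "\<dots> = ennreal t * emeasure M (E - F)"
    by (simp add: nn_integral_cmult_indicator M12)
  finally have le: "ennreal t * emeasure M (E - F) + ?R \<le> ennreal t * emeasure M (E - F) + 0"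
    by simp
  have "ennreal t * emeasure M (E - F) \<noteq> \<infinity>"
    using finI t by (simp add: ennreal_mult_eq_top_iff)
  then have "?R = 0"
    using le by (subst (asm) ennreal_add_left_cancel_le) auto
  then have "AE p in M. (\<phi> p - ennreal t) * indicator (E - F) p = 0"
    by (subst (asm) nn_integral_0_iff_AE) auto
  then have "AE p in M. p \<notin> E - F"
    by eventually_elim (auto simp: E_def indicator_def dest: ennreal_minus_eq_0 leD)
  then have "emeasure M (E - F) = 0"
    by (subst (asm) AE_iff_null_sets[symmetric]) auto
  then show ?thesis
    using M12 by (auto simp: F_def[symmetric])
qed

section \<open>No invariant probability with bounded density\<close>

lemma null_sets_lebesgue_square:
  "A \<in> null_sets lebesgue_square \<longleftrightarrow> A \<in> null_sets lborel \<and> A \<subseteq> {0..1} \<times> {0..1}"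
  unfolding lebesgue_square_def by (subst null_sets_restrict_space) auto

lemma T_slow_inverse_branch:
  assumes "0 \<le> u" "u < 1" "0 \<le> v" "v \<le> 1"
  shows "T_slow (u / (1 + u), v / (1 + u)) = (u, v)"
proof -
  have "1 - u / (1 + u) = 1 / (real 1 + u)"
    using assms by (simp add: field_simps)
  moreover have "v / (1 + u) \<le> 1 / (1 + u)"
    using assms by (simp add: divide_right_mono)
  ultimately show ?thesis
    using assms gauss_map_inverse_branch[of u 1] by (simp add: T_slow_def)
qed

text \<open>
  Descent on \<open>K\<close>: the inverse branch maps \<open>E \<inter> {1 / x > K}\<close> into \<open>T\<^sup>-\<^sup>1 E \<inter> {1 / x > K + 1}\<close>. The
  latter is null if \<open>E \<inter> {1 / x > K + 1}\<close> is, because \<open>T\<^sup>-\<^sup>1 E\<close> exceeds \<open>E\<close> by a null set only; and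
  undoing the branch, a differentiable map, keeps null sets null. At \<open>K = 0\<close> only the line \<open>x = 0\<close>
  is missing.
\<close>

lemma null_set_bounded_away_backward_invariant:
  assumes E: "E \<in> sets lebesgue_square"
    and inv: "(T_slow -` E \<inter> space lebesgue_square) - E \<in> null_sets lebesgue_square"
    and away: "E \<inter> {p. real K < 1 / fst p} \<in> null_sets lebesgue_square"
  shows "E \<in> null_sets lebesgue_square"
  using away
proof (induction K)
  case 0
  then have "AE p in lebesgue_square. p \<notin> E \<inter> {p. real 0 < 1 / fst p}"
    by (rule AE_not_in)
  then have "AE p in lebesgue_square. p \<notin> E"
    using AE_fst_neq[of 0] AE_space by eventually_elim auto
  then show ?case
    using E by (simp add: AE_iff_null_sets)
next
  case (Suc K)
  define N where "N = (T_slow -` E \<inter> space lebesgue_square) \<inter> {p. real (Suc K) < 1 / fst p}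
    \<inter> {p. fst p < 1}"
  \<comment> \<open>\<open>B\<close> is the map itself on the image of the inverse branch; it is singular on the line \<open>x = 1\<close>.\<close>
  define B where "B p = (fst p / (1 - fst p), snd p / (1 - fst p))" for p :: "real \<times> real"
  define S where "S = E \<inter> {p. real K < 1 / fst p} \<inter> {p. fst p < 1}"
  have [measurable]: "E \<in> sets borel"
    using E by (simp add: in_sets_lebesgue_square)
  have TE: "T_slow -` E \<inter> space lebesgue_square \<in> sets borel"
    using measurable_sets[OF T_slow_measurable_square E] by (simp add: in_sets_lebesgue_square)
  have bands: "{p :: real \<times> real. real (Suc K) < 1 / fst p} \<in> sets borel"
      "{p :: real \<times> real. fst p < 1} \<in> sets borel"
    by measurable
  have "N \<in> sets borel"
    unfolding N_def by (rule sets.Int[OF sets.Int[OF TE bands(1)] bands(2)])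
  then have "N \<in> null_sets lebesgue_square"
    by (intro null_sets_subset[OF null_sets.Un[OF inv Suc.prems]])
       (auto simp: N_def in_sets_lebesgue_square)
  then have "negligible N"
    by (auto simp: null_sets_lebesgue_square negligible_iff_null_sets intro: null_sets_completionI)
  moreover have "B differentiable_on N"
    unfolding B_def differentiable_on_def N_def
    by (auto intro!: derivative_intros differentiable_Pair
        bounded_linear_imp_differentiable[OF bounded_linear_fst]
        bounded_linear_imp_differentiable[OF bounded_linear_snd])
  ultimately have "negligible (B ` N)"
    by (intro negligible_differentiable_image_negligible) auto
  moreover have "S \<subseteq> B ` N"
  proof
    fix p assume p: "p \<in> S"
    obtain u v where uv: "p = (u, v)" by (cases p)
    have "p \<in> E" "real K < 1 / u" "u < 1" using p by (auto simp: S_def uv)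
    moreover have "0 < 1 / u"
      using \<open>real K < 1 / u\<close> by (rule le_less_trans[rotated]) simp
    ultimately have u: "0 < u" "u < 1" "0 \<le> v" "v \<le> 1" "(u, v) \<in> E" "real K < 1 / u"
      using E by (auto simp: in_sets_lebesgue_square uv)
    let ?q = "(u / (1 + u), v / (1 + u))"
    have "B ?q = p"
      using u by (simp add: B_def uv field_simps)
    moreover have "?q \<in> N"
    proof -
      have "1 / (u / (1 + u)) = 1 / u + 1" using u by (simp add: field_simps)
      then show ?thesis
        using u T_slow_inverse_branch[of u v] by (auto simp: N_def divide_simps distrib_right)
    qed
    ultimately show "p \<in> B ` N" by blast
  qed
  ultimately have "negligible S"
    by (rule negligible_subset)
  moreover have "S \<in> sets borel"
    unfolding S_def by measurable
  ultimately have "S \<in> null_sets lborel"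
    by (auto simp: negligible_iff_null_sets null_sets_completion_iff)
  then have "S \<in> null_sets lebesgue_square"
    using E by (auto simp: null_sets_lebesgue_square S_def in_sets_lebesgue_square)
  then have "AE p in lebesgue_square. p \<notin> S"
    by (rule AE_not_in)
  then have "AE p in lebesgue_square. p \<notin> E \<inter> {p. real K < 1 / fst p}"
    using AE_fst_neq[of 1] AE_space by eventually_elim (auto simp: S_def)
  moreover have "E \<inter> {p. real K < 1 / fst p} \<in> sets lebesgue_square"
    using E by (auto simp: in_sets_lebesgue_square)
  ultimately have "E \<inter> {p. real K < 1 / fst p} \<in> null_sets lebesgue_square"
    by (simp add: AE_iff_null_sets)
  then show ?case
    by (rule Suc.IH)
qed

text \<open>
  With \<open>\<phi>\<close> the density of \<open>\<nu>\<close> relative to \<open>\<mu>\<close>, the bound \<open>\<phi>(x, y) \<le> C x\<close> gives \<open>1 / x < C / t\<close> on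
  \<open>{\<phi> > t}\<close>, so any \<open>K \<ge> C / t\<close> starts the descent above.
\<close>

lemma no_invariant_probability_bounded_density:
  assumes sets: "sets \<nu> = sets lebesgue_square"
    and prob: "prob_space \<nu>"
    and ac: "absolutely_continuous lebesgue_square \<nu>"
    and bound: "AE p in lebesgue_square. RN_deriv lebesgue_square \<nu> p \<le> ennreal C"
    and inv: "preserves T_slow \<nu>"
  shows False
proof -
  define g where "g = RN_deriv lebesgue_square \<nu>"
  define \<phi> where "\<phi> p = g p * ennreal (fst p)" for p
  have [measurable]: "g \<in> borel_measurable lebesgue_square"
    unfolding g_def by measurable
  have [measurable]: "\<phi> \<in> borel_measurable lebesgue_square"
    unfolding \<phi>_def by measurable
  have dens: "density slow_measure \<phi> = \<nu>"
  proof -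
    have "density slow_measure \<phi> = density lebesgue_square (\<lambda>p. ennreal (1 / fst p) * \<phi> p)"
      unfolding slow_measure_def by (rule density_density_eq) measurable
    also have "\<dots> = density lebesgue_square g"
    proof (rule density_cong)
      show "AE p in lebesgue_square. ennreal (1 / fst p) * \<phi> p = g p"
        using AE_fst_neq[of 0] AE_space
      proof eventually_elim
        case (elim p)
        then have "ennreal (1 / fst p) * ennreal (fst p) = 1"
          by (subst ennreal_mult[symmetric]) auto
        then show ?case
          unfolding \<phi>_def by (metis mult.assoc mult.commute mult.right_neutral)
      qed
    qed measurable
    also have "\<dots> = \<nu>"
      unfolding g_def
      by (rule sigma_finite_measure.density_RN_deriv[OF sigma_finite_lebesgue_square ac sets])
    finally show ?thesis .
  qed
  have space: "space \<nu> = {0..1} \<times> {0..1}"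
    using sets_eq_imp_space_eq[OF sets] by simp
  have one: "emeasure \<nu> (space slow_measure) = 1"
    using prob_space.emeasure_space_1[OF prob] by (simp add: space)
  have le: "AE p in lebesgue_square. \<phi> p \<le> ennreal t" if t: "0 < t" for t :: real
  proof -
    define E where "E = {p \<in> space slow_measure. ennreal t < \<phi> p}"
    have Es: "E \<in> sets lebesgue_square"
      unfolding E_def space_slow_measure space_lebesgue_square[symmetric] by measurable
    have "T_slow -` E \<inter> space slow_measure - E \<in> null_sets slow_measure"
      unfolding E_def
      by (rule null_sets_vimage_superlevel_diff)
         (use preserves_slow_measure inv t one in \<open>auto simp: dens\<close>)
    then have 1: "T_slow -` E \<inter> space lebesgue_square - E \<in> null_sets lebesgue_square"
      by (simp add: null_sets_slow_measure)
    obtain K :: nat where K: "C / t \<le> real K"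
      using real_arch_simple by blast
    have "AE p in lebesgue_square. p \<notin> E \<inter> {p. real K < 1 / fst p}"
      using bound AE_space
    proof eventually_elim
      case (elim p)
      show ?case
      proof
        assume "p \<in> E \<inter> {p. real K < 1 / fst p}"
        then have p: "ennreal t < \<phi> p" "real K < 1 / fst p" by (auto simp: E_def)
        have x: "0 \<le> fst p" using elim by auto
        have "\<phi> p \<le> ennreal (C * fst p)"
          using elim(1) x by (simp add: \<phi>_def g_def ennreal_mult'' mult_right_mono)
        with p(1) have "t < C * fst p"
          using t by (metis ennreal_leI leD leI order_less_le_trans)
        moreover have "0 < 1 / fst p"
          using p(2) by (rule le_less_trans[rotated]) simp
        ultimately have "1 / fst p < C / t"
          using t by (simp add: field_simps)
        with K p(2) show False by linarith
      qed
    qed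
    moreover have "E \<inter> {p. real K < 1 / fst p} \<in> sets lebesgue_square"
    proof -
      have "{p :: real \<times> real. real K < 1 / fst p} \<in> sets borel" by measurable
      then show ?thesis
        using Es by (auto simp: in_sets_lebesgue_square)
    qed
    ultimately have "E \<inter> {p. real K < 1 / fst p} \<in> null_sets lebesgue_square"
      by (simp add: AE_iff_null_sets)
    from null_set_bounded_away_backward_invariant[OF Es 1 this]
    have "AE p in lebesgue_square. p \<notin> E"
      by (rule AE_not_in)
    then show ?thesis
      using AE_space by eventually_elim (auto simp: E_def not_less)
  qed
  have "AE p in lebesgue_square. \<forall>n. \<phi> p \<le> ennreal (1 / real (Suc n))"
    by (subst AE_all_countable) (intro allI le, simp)
  then have "AE p in lebesgue_square. \<phi> p = 0"
  proof eventually_elim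
    case (elim p)
    have "(\<lambda>n. ennreal (1 / real (Suc n))) \<longlonglongrightarrow> ennreal 0"
      by (intro tendsto_ennrealI) real_asymp
    with elim have "\<phi> p \<le> ennreal 0"
      by (intro LIMSEQ_le_const) auto
    then show ?case by simp
  qed
  then have "AE p in slow_measure. \<phi> p = 0"
    unfolding slow_measure_def by (subst AE_density) auto
  then have "emeasure (density slow_measure \<phi>) (space slow_measure) = 0"
    by (subst emeasure_density)
       (auto simp: nn_integral_0_iff_AE in_sets_lebesgue_square elim!: eventually_mono)
  with one show False
    by (simp add: dens)
qed

theorem corollary2p7:
  shows "(\<nexists>\<nu> :: (real \<times> real) measure.
            sets \<nu> = sets lebesgue_square \<and>
            prob_space \<nu> \<and>
            absolutely_continuous lebesgue_square \<nu> \<and>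
            (\<exists>C::real. AE p in lebesgue_square. RN_deriv lebesgue_square \<nu> p \<le> ennreal C) \<and>
            preserves T_slow \<nu>)
       \<and> (\<exists>\<mu> :: (real \<times> real) measure.
            sets \<mu> = sets lebesgue_square \<and>
            sigma_finite_measure \<mu> \<and>
            absolutely_continuous lebesgue_square \<mu> \<and>
            absolutely_continuous \<mu> lebesgue_square \<and>
            emeasure \<mu> ({0..1} \<times> {0..1}) = \<infinity> \<and>
            preserves T_slow \<mu>)"
proof (intro conjI)
  show "\<nexists>\<nu> :: (real \<times> real) measure.
            sets \<nu> = sets lebesgue_square \<and>
            prob_space \<nu> \<and>
            absolutely_continuous lebesgue_square \<nu> \<and>
            (\<exists>C::real. AE p in lebesgue_square. RN_deriv lebesgue_square \<nu> p \<le> ennreal C) \<and>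
            preserves T_slow \<nu>"
    using no_invariant_probability_bounded_density by blast
next
  show "\<exists>\<mu> :: (real \<times> real) measure.
            sets \<mu> = sets lebesgue_square \<and>
            sigma_finite_measure \<mu> \<and>
            absolutely_continuous lebesgue_square \<mu> \<and>
            absolutely_continuous \<mu> lebesgue_square \<and>
            emeasure \<mu> ({0..1} \<times> {0..1}) = \<infinity> \<and>
            preserves T_slow \<mu>"
    using sigma_finite_slow_measure preserves_slow_measure emeasure_slow_measure_square
    by (intro exI[of _ slow_measure]) (simp add: absolutely_continuous_def null_sets_slow_measure)
qed

end
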